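(* Let $\mathbf{N}$ be the structure with universe $N=\{0,1,2\}$ and one ternary relation $R^{\mathbf{N}}=\{(a,b,c)\in N^3\mid \{a,b,c\}\neq N\}$. Let $D=\{0,1\}$ and let $F$ be the encoding consisting of the three maps $\bar0,\bar1,\bar2$ from $D^0$ to $N$ (where $\bar b$ sends the empty tuple to $b$) together with all injective maps from $D$ to $N$. Then $\mathbf{N}$ is $F$-stable.
   Context: A $\wedge$-formula is a conjunction of atoms $R(v_1,\dots,v_k)$ and variable equalities with the usual satisfaction over a structure. For a finite set $S$, a set of maps $S\to N$ is $\wedge$-definable over $\mathbf{N}$ if it is the set of satisfying assignments $S\to N$ of a $\wedge$-formula with variables from $S$; $\langle T\rangle_{\mathbf{N}}$ is the smallest $\wedge$-definable set of maps containing $T$. An automorphism is a bijection of $N$ preserving $R^{\mathbf{N}}$ in both directions. A set $T$ of maps $I\to N$ is surjectively closed over $\mathbf{N}$ if every surjective map in $\langle T\rangle_{\mathbf{N}}$ equals $\gamma\circ t$ for an automorphism $\gamma$ and $t\in T$. For an encoding $F$ (finite set of maps $D^k\to N$, $k\ge0$ the arity, $D^0=\{\text{empty tuple}\}$) and a finite set $V$: $G_{V,D}$ = all maps $V\to D$; a $(V,F)$-application is a pair $(\bar v,f)$, $f\in F$, $\bar v$ a tuple over $V$ of length the arity of $f$; $A_{V,F}$ the set of them; for $g\in G_{V,D}$, $\alpha=((v_1,\dots,v_k),f)$, $\alpha[g]=f(g(v_1),\dots,g(v_k))$; $t[g]:\alpha\mapsto\alpha[g]$; $T_V=\{t[g]\mid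 g\in G_{V,D}\}$. The structure is $F$-stable if for every non-empty finite $V$, every map in $T_V$ is surjective and $T_V$ is surjectively closed. *)

theory Defs
  imports "HOL-Library.FuncSet"
begin

text \<open>
  Maps \<open>A \<rightarrow> B\<close> between sets are the extensional functions \<^term>\<open>A \<rightarrow>\<^sub>E B\<close>, so that two maps are
  equal iff they agree on \<open>A\<close>.  Tuples are lists; \<open>tuples X k\<close> is the power \<open>X\<close> to the \<open>k\<close>, and
  \<open>tuples X 0 = {[]}\<close>.
\<close>

definition tuples :: "'a set \<Rightarrow> nat \<Rightarrow> 'a list set" where
  "tuples X k = {xs. length xs = k \<and> set xs \<subseteq> X}"


subsection \<open>Relational structures and conjunctive formulas\<close>

text \<open>The relation symbols of the signature are the elements of the type \<open>'r\<close>.\<close>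

record ('r, 'n) rel_structure =
  universe :: "'n set"
  arity :: "'r \<Rightarrow> nat"
  interp :: "'r \<Rightarrow> 'n list set"

definition is_structure :: "('r, 'n) rel_structure \<Rightarrow> bool" where
  "is_structure N \<longleftrightarrow> universe N \<noteq> {} \<and> (\<forall>R. interp N R \<subseteq> tuples (universe N) (arity N R))"

datatype ('r, 'v) conjunct = Atom 'r "'v list" | Equality 'v 'v

fun conjunct_over :: "('r, 'n) rel_structure \<Rightarrow> 'v set \<Rightarrow> ('r, 'v) conjunct \<Rightarrow> bool" where
  "conjunct_over N S (Atom R vs) \<longleftrightarrow> vs \<in> tuples S (arity N R)"
| "conjunct_over N S (Equality u v) \<longleftrightarrow> u \<in> S \<and> v \<in> S"

fun conjunct_sat :: "('r, 'n) rel_structure \<Rightarrow> ('v \<Rightarrow> 'n) \<Rightarrow> ('r, 'v) conjunct \<Rightarrow> bool" where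
  "conjunct_sat N h (Atom R vs) \<longleftrightarrow> map h vs \<in> interp N R"
| "conjunct_sat N h (Equality u v) \<longleftrightarrow> h u = h v"

text \<open>A conjunctive formula is the finite list of its conjuncts; the empty conjunction is true.\<close>

type_synonym ('r, 'v) conj_formula = "('r, 'v) conjunct list"

definition formula_over :: "('r, 'n) rel_structure \<Rightarrow> 'v set \<Rightarrow> ('r, 'v) conj_formula \<Rightarrow> bool" where
  "formula_over N S \<phi> \<longleftrightarrow> (\<forall>c\<in>set \<phi>. conjunct_over N S c)"

definition sat :: "('r, 'n) rel_structure \<Rightarrow> ('v \<Rightarrow> 'n) \<Rightarrow> ('r, 'v) conj_formula \<Rightarrow> bool" where
  "sat N h \<phi> \<longleftrightarrow> (\<forall>c\<in>set \<phi>. conjunct_sat N h c)"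

definition conj_definable :: "('r, 'n) rel_structure \<Rightarrow> 'v set \<Rightarrow> ('v \<Rightarrow> 'n) set \<Rightarrow> bool" where
  "conj_definable N S U \<longleftrightarrow>
     (\<exists>\<phi>. formula_over N S \<phi> \<and> U = {h \<in> S \<rightarrow>\<^sub>E universe N. sat N h \<phi>})"

text \<open>
  \<open>LEAST\<close> refers to inclusion of sets.  The least set exists for finite \<open>S\<close> and finite universe,
  see \<open>conj_hull_is_least\<close> below.
\<close>

definition conj_hull :: "('r, 'n) rel_structure \<Rightarrow> 'v set \<Rightarrow> ('v \<Rightarrow> 'n) set \<Rightarrow> ('v \<Rightarrow> 'n) set" where
  "conj_hull N S T = (LEAST U. conj_definable N S U \<and> T \<subseteq> U)"

lemma conj_definable_all: "conj_definable N S (S \<rightarrow>\<^sub>E universe N)"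
  unfolding conj_definable_def
  by (rule exI[of _ "[]"]) (simp add: formula_over_def sat_def)

lemma conj_definable_Int:
  assumes "conj_definable N S U" "conj_definable N S W"
  shows "conj_definable N S (U \<inter> W)"
proof -
  obtain \<phi> \<psi> where
    "formula_over N S \<phi>" "U = {h \<in> S \<rightarrow>\<^sub>E universe N. sat N h \<phi>}"
    "formula_over N S \<psi>" "W = {h \<in> S \<rightarrow>\<^sub>E universe N. sat N h \<psi>}"
    using assms unfolding conj_definable_def by blast
  then show ?thesis
    unfolding conj_definable_def
    by (intro exI[of _ "\<phi> @ \<psi>"]) (auto simp: formula_over_def sat_def)
qed

lemma conj_definable_Inter:
  assumes "finite \<U>" "\<U> \<noteq> {}" "\<And>U. U \<in> \<U> \<Longrightarrow> conj_definable N S U"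
  shows "conj_definable N S (\<Inter>\<U>)"
  using assms by (induction \<U> rule: finite_ne_induct) (auto intro: conj_definable_Int)

lemma conj_hull_eq_Inter:
  assumes "finite S" "finite (universe N)" "T \<subseteq> S \<rightarrow>\<^sub>E universe N"
  shows "conj_hull N S T = \<Inter>{U. conj_definable N S U \<and> T \<subseteq> U}"
    and conj_hull_is_least:
      "conj_definable N S (conj_hull N S T) \<and> T \<subseteq> conj_hull N S T \<and>
       (\<forall>U. conj_definable N S U \<and> T \<subseteq> U \<longrightarrow> conj_hull N S T \<subseteq> U)"
proof -
  let ?\<U> = "{U. conj_definable N S U \<and> T \<subseteq> U}"
  have "?\<U> \<subseteq> Pow (S \<rightarrow>\<^sub>E universe N)"
    unfolding conj_definable_def by blast
  moreover have "finite (S \<rightarrow>\<^sub>E universe N)"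
    using assms by (intro finite_PiE) auto
  ultimately have fin: "finite ?\<U>"
    by (meson finite_Pow_iff finite_subset)
  have "(S \<rightarrow>\<^sub>E universe N) \<in> ?\<U>"
    using assms(3) conj_definable_all by blast
  then have def: "conj_definable N S (\<Inter>?\<U>)"
    using fin by (intro conj_definable_Inter) auto
  show eq: "conj_hull N S T = \<Inter>?\<U>"
    unfolding conj_hull_def using def by (intro Least_equality) blast+
  show "conj_definable N S (conj_hull N S T) \<and> T \<subseteq> conj_hull N S T \<and>
       (\<forall>U. conj_definable N S U \<and> T \<subseteq> U \<longrightarrow> conj_hull N S T \<subseteq> U)"
    unfolding eq using def by blast
qed

definition automorphism :: "('r, 'n) rel_structure \<Rightarrow> ('n \<Rightarrow> 'n) \<Rightarrow> bool" where
  "automorphism N \<gamma> \<longleftrightarrow> bij_betw \<gamma> (universe N) (universe N) \<and>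
     (\<forall>R. \<forall>xs\<in>tuples (universe N) (arity N R). xs \<in> interp N R \<longleftrightarrow> map \<gamma> xs \<in> interp N R)"

definition surjectively_closed :: "('r, 'n) rel_structure \<Rightarrow> 'i set \<Rightarrow> ('i \<Rightarrow> 'n) set \<Rightarrow> bool" where
  "surjectively_closed N I T \<longleftrightarrow>
     (\<forall>h\<in>conj_hull N I T. h ` I = universe N \<longrightarrow>
        (\<exists>\<gamma> t. automorphism N \<gamma> \<and> t \<in> T \<and> h = compose I \<gamma> t))"


subsection \<open>Encodings and stability\<close>

text \<open>
  The members of an encoding may have different arities; each map is paired with its arity.
\<close>

type_synonym ('d, 'n) enc_map = "nat \<times> ('d list \<Rightarrow> 'n)"

definition is_encoding :: "'n set \<Rightarrow> 'd set \<Rightarrow> ('d, 'n) enc_map set \<Rightarrow> bool" where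
  "is_encoding N D F \<longleftrightarrow> finite F \<and> (\<forall>(k, f)\<in>F. f \<in> tuples D k \<rightarrow>\<^sub>E N)"

type_synonym ('v, 'd, 'n) application = "'v list \<times> ('d, 'n) enc_map"

definition applications :: "'v set \<Rightarrow> ('d, 'n) enc_map set \<Rightarrow> ('v, 'd, 'n) application set" where
  "applications V F = {(vs, (k, f)) | vs k f. (k, f) \<in> F \<and> vs \<in> tuples V k}"

definition app_value :: "('v, 'd, 'n) application \<Rightarrow> ('v \<Rightarrow> 'd) \<Rightarrow> 'n" where
  "app_value \<alpha> g = (case \<alpha> of (vs, (k, f)) \<Rightarrow> f (map g vs))"

definition app_map ::
    "'v set \<Rightarrow> ('d, 'n) enc_map set \<Rightarrow> ('v \<Rightarrow> 'd) \<Rightarrow> ('v, 'd, 'n) application \<Rightarrow> 'n" where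
  "app_map V F g = (\<lambda>\<alpha>\<in>applications V F. app_value \<alpha> g)"

definition app_maps ::
    "'v set \<Rightarrow> 'd set \<Rightarrow> ('d, 'n) enc_map set \<Rightarrow> (('v, 'd, 'n) application \<Rightarrow> 'n) set" where
  "app_maps V D F = {app_map V F g | g. g \<in> V \<rightarrow>\<^sub>E D}"

text \<open>
  The sets \<open>V\<close> of variables range over the non-empty finite subsets of a type \<open>'v\<close>, which is a
  parameter of the definition; stability means stability for every type \<open>'v\<close>.
\<close>

definition stable ::
    "'v itself \<Rightarrow> ('r, 'n) rel_structure \<Rightarrow> 'd set \<Rightarrow> ('d, 'n) enc_map set \<Rightarrow> bool" where
  "stable (_ :: 'v itself) N D F \<longleftrightarrow>
     (\<forall>V :: 'v set. V \<noteq> {} \<and> finite V \<longrightarrow>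
        (\<forall>t\<in>app_maps V D F. t ` applications V F = universe N) \<and>
        surjectively_closed N (applications V F) (app_maps V D F))"


subsection \<open>The no-rainbow structure and its encoding\<close>

text \<open>The signature has a single symbol, the element of type \<^typ>\<open>unit\<close>.\<close>

definition no_rainbow :: "(unit, nat) rel_structure" where
  "no_rainbow =
     \<lparr>universe = {0, 1, 2},
      arity = (\<lambda>_. 3),
      interp = (\<lambda>_. {[a, b, c] | a b c.
        a \<in> {0, 1, 2} \<and> b \<in> {0, 1, 2} \<and> c \<in> {0, 1, 2} \<and> {a, b, c} \<noteq> {0, 1, 2}})\<rparr>"

abbreviation bool_domain :: "nat set" where
  "bool_domain \<equiv> {0, 1}"

definition const_map :: "nat \<Rightarrow> (nat, nat) enc_map" where
  "const_map b = (0, \<lambda>xs\<in>tuples bool_domain 0. b)"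

text \<open>A map on the domain itself is a map on its 1-tuples.\<close>

definition no_rainbow_encoding :: "(nat, nat) enc_map set" where
  "no_rainbow_encoding =
     {const_map 0, const_map 1, const_map 2} \<union>
     {(1, f) | f. f \<in> tuples bool_domain 1 \<rightarrow>\<^sub>E universe no_rainbow \<and> inj_on f (tuples bool_domain 1)}"

lemma is_structure_no_rainbow: "is_structure no_rainbow"
  by (auto simp: is_structure_def no_rainbow_def tuples_def)

lemma is_encoding_no_rainbow_encoding:
  "is_encoding (universe no_rainbow) bool_domain no_rainbow_encoding"
proof -
  have "finite (tuples bool_domain 1)"
    using finite_lists_length_eq[of bool_domain 1] by (simp add: tuples_def conj_commute)
  then have "finite (tuples bool_domain 1 \<rightarrow>\<^sub>E universe no_rainbow)"
    by (intro finite_PiE) (auto simp: no_rainbow_def)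
  then have "finite (Pair (1 :: nat) ` (tuples bool_domain 1 \<rightarrow>\<^sub>E universe no_rainbow))"
    by simp
  then have "finite no_rainbow_encoding"
    unfolding no_rainbow_encoding_def
    by (intro finite_UnI) (auto intro: finite_subset[rotated])
  then show ?thesis
    by (auto simp: is_encoding_def no_rainbow_encoding_def const_map_def no_rainbow_def)
qed

end

theory Submission
  imports Defs
begin

text \<open>
  The automorphisms are all permutations of \<open>N\<close>, and an element \<open>h\<close> of the hull satisfies every
  constraint \<open>R(x, y, z)\<close> that holds in all maps \<open>t[g]\<close>.  Write \<open>c\<^sub>a\<close> for the constant applications
  and \<open>v\<^sub>a\<^sub>b\<close> for the application to \<open>v\<close> of the injection \<open>0 \<mapsto> a, 1 \<mapsto> b\<close>; let \<open>a, b, c\<close> be distinct.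

  If \<open>h\<close> is injective on the constants, it agrees with a permutation of \<open>N\<close> there.  Then
  \<open>R(c\<^sub>a, c\<^sub>b, v\<^sub>a\<^sub>b)\<close>, \<open>R(v\<^sub>a\<^sub>b, v\<^sub>a\<^sub>c, c\<^sub>b)\<close> and \<open>R(v\<^sub>a\<^sub>b, v\<^sub>c\<^sub>b, c\<^sub>a)\<close> force the six values \<open>h v\<^sub>a\<^sub>b\<close> to encode
  one bit, which defines \<open>g\<close>.

  If \<open>h\<close> has exactly two values on the constants, say \<open>h c\<^sub>a = h c\<^sub>b \<noteq> h c\<^sub>c\<close>, then by
  \<open>R(c\<^sub>a, c\<^sub>c, v\<^sub>a\<^sub>c)\<close> and its analogues the third value can only be attained at \<open>v\<^sub>a\<^sub>b\<close> or \<open>v\<^sub>b\<^sub>a\<close>, and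
  \<open>R(v\<^sub>a\<^sub>b, v\<^sub>a\<^sub>c, c\<^sub>b)\<close>, \<open>R(v\<^sub>a\<^sub>b, v\<^sub>a\<^sub>c, c\<^sub>c)\<close> exclude this.

  If \<open>h\<close> has a single value \<open>p\<close> on the constants, then two applications \<open>\<alpha>, \<beta>\<close> carrying the other two
  values do not satisfy any constraint \<open>R(\<alpha>, \<beta>, c\<^sub>x)\<close>.  So they are \<open>v\<^sub>a\<^sub>b\<close> and \<open>u\<^sub>a\<^sub>c\<close> up to orientation,
  with \<open>u \<noteq> v\<close>, and constraints such as \<open>R(v\<^sub>a\<^sub>b, v\<^sub>a\<^sub>c, u\<^sub>b\<^sub>c)\<close> give a contradiction.
\<close>

section \<open>Applications of the encoding\<close>

lemma universe_no_rainbow: "universe no_rainbow = {0, 1, 2}"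
  by (simp add: no_rainbow_def)

definition edge_map :: "nat \<Rightarrow> nat \<Rightarrow> (nat, nat) enc_map" where
  "edge_map a b = (1, \<lambda>xs\<in>tuples bool_domain 1. if xs = [0] then a else b)"

abbreviation const_app :: "nat \<Rightarrow> ('v, nat, nat) application" where
  "const_app a \<equiv> ([], const_map a)"

abbreviation edge_app :: "'v \<Rightarrow> nat \<Rightarrow> nat \<Rightarrow> ('v, nat, nat) application" where
  "edge_app v a b \<equiv> ([v], edge_map a b)"

lemma tuples_0 [simp]: "tuples X 0 = {[]}"
  by (auto simp: tuples_def)

lemma tuples_1: "tuples X (Suc 0) = {[x] | x. x \<in> X}"
  by (auto simp: tuples_def length_Suc_conv)

lemma edge_maps:
  "{(1, f) | f. f \<in> tuples bool_domain 1 \<rightarrow>\<^sub>E universe no_rainbow \<and> inj_on f (tuples bool_domain 1)}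
    = {edge_map a b | a b. a \<in> universe no_rainbow \<and> b \<in> universe no_rainbow \<and> a \<noteq> b}" (is "?L = ?R")
proof
  have T: "tuples bool_domain 1 = {[0], [1]}"
    by (auto simp: tuples_1)
  show "?L \<subseteq> ?R"
  proof
    fix p assume "p \<in> ?L"
    then obtain f where p: "p = (1, f)" and f: "f \<in> {[0], [1]} \<rightarrow>\<^sub>E universe no_rainbow" "inj_on f {[0], [1]}"
      unfolding T by auto
    have "f = (\<lambda>xs\<in>{[0], [1]}. if xs = [0] then f [0] else f [1])"
      using f(1) by (intro extensionalityI[of _ "{[0], [1]}"]) (auto simp: PiE_def)
    then have "p = edge_map (f [0]) (f [1])"
      unfolding edge_map_def T p by simp
    moreover have "f [0] \<in> universe no_rainbow" "f [1] \<in> universe no_rainbow"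
      using f(1) by blast+
    moreover have "f [0] \<noteq> f [1]"
      using f(2) by (auto simp: inj_on_def)
    ultimately show "p \<in> ?R" by blast
  qed
  show "?R \<subseteq> ?L"
    unfolding edge_map_def T by (auto simp: inj_on_def)
qed

lemma applications_no_rainbow:
  "applications V no_rainbow_encoding =
     const_app ` universe no_rainbow \<union>
     {edge_app v a b | v a b. v \<in> V \<and> a \<in> universe no_rainbow \<and> b \<in> universe no_rainbow \<and> a \<noteq> b}"
proof -
  have enc: "no_rainbow_encoding = const_map ` universe no_rainbow \<union>
      {edge_map a b | a b. a \<in> universe no_rainbow \<and> b \<in> universe no_rainbow \<and> a \<noteq> b}"
    unfolding no_rainbow_encoding_def edge_maps by (simp add: universe_no_rainbow)
  have "(vs, p) \<in> applications V no_rainbow_encoding \<longleftrightarrow>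
      p \<in> no_rainbow_encoding \<and> vs \<in> tuples V (fst p)" for vs p
    unfolding applications_def by (cases p) auto
  moreover have "fst (const_map b) = 0" "fst (edge_map a b) = Suc 0" for a b
    by (simp_all add: const_map_def edge_map_def)
  ultimately have "(vs, p) \<in> applications V no_rainbow_encoding \<longleftrightarrow>
     (vs, p) \<in> const_app ` universe no_rainbow \<union>
       {edge_app v a b | v a b. v \<in> V \<and> a \<in> universe no_rainbow \<and> b \<in> universe no_rainbow \<and> a \<noteq> b}" for vs p
    unfolding enc by (auto simp: tuples_1)
  then show ?thesis unfolding set_eq_iff split_paired_All by blast
qed

lemma app_value_const_app [simp]: "app_value (const_app a) g = a"
  by (simp add: app_value_def const_map_def)

lemma app_value_edge_app:
  "g v \<in> bool_domain \<Longrightarrow> app_value (edge_app v a b) g = (if g v = 0 then a else b)"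
  by (auto simp: app_value_def edge_map_def tuples_1)

text \<open>The hull is given by \<open>LEAST\<close>; \<open>conj_hull_is_least\<close> turns this
  into a usable property over a finite set of applications.\<close>

lemma finite_applications:
  assumes "finite V"
  shows "finite (applications V no_rainbow_encoding)"
proof -
  have "applications V no_rainbow_encoding \<subseteq> const_app ` universe no_rainbow \<union>
      (\<lambda>(v, a, b). edge_app v a b) ` (V \<times> universe no_rainbow \<times> universe no_rainbow)"
    unfolding applications_no_rainbow by (intro Un_mono) force+
  then show ?thesis
    by (rule finite_subset) (use assms in \<open>simp add: universe_no_rainbow\<close>)
qed

lemma app_maps_no_rainbow_subset:
  "app_maps V bool_domain no_rainbow_encoding \<subseteq>
     applications V no_rainbow_encoding \<rightarrow>\<^sub>E universe no_rainbow"
proof -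
  have "app_value \<alpha> g \<in> universe no_rainbow"
    if "\<alpha> \<in> applications V no_rainbow_encoding" "g \<in> V \<rightarrow>\<^sub>E bool_domain" for \<alpha> g
  proof -
    have "g v \<in> bool_domain" if "v \<in> V" for v
      using \<open>g \<in> V \<rightarrow>\<^sub>E bool_domain\<close> that by blast
    then show ?thesis
      using that(1) unfolding applications_no_rainbow by (auto simp: app_value_edge_app)
  qed
  then show ?thesis
    unfolding app_maps_def app_map_def by auto
qed

section \<open>Rainbow triples and automorphisms\<close>

lemma interp_no_rainbow_iff:
  assumes "x \<in> universe no_rainbow" "y \<in> universe no_rainbow" "z \<in> universe no_rainbow"
  shows "[x, y, z] \<in> interp no_rainbow R \<longleftrightarrow> \<not> distinct [x, y, z]"
proof -
  have interp: "interp no_rainbow R =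
      {[a, b, c] | a b c. a \<in> universe no_rainbow \<and> b \<in> universe no_rainbow \<and>
         c \<in> universe no_rainbow \<and> {a, b, c} \<noteq> universe no_rainbow}"
    by (simp only: no_rainbow_def rel_structure.simps)
  have "distinct [x, y, z] \<longleftrightarrow> card (set [x, y, z]) = length [x, y, z]"
    by (metis card_distinct distinct_card)
  also have "\<dots> \<longleftrightarrow> set [x, y, z] = universe no_rainbow"
  proof
    assume "card (set [x, y, z]) = length [x, y, z]"
    moreover have "set [x, y, z] \<subseteq> universe no_rainbow"
      using assms by simp
    ultimately show "set [x, y, z] = universe no_rainbow"
      by (intro card_subset_eq) (simp_all add: universe_no_rainbow)
  next
    assume "set [x, y, z] = universe no_rainbow"
    then show "card (set [x, y, z]) = length [x, y, z]" by (simp only:) (simp add: universe_no_rainbow)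
  qed
  finally have "distinct [x, y, z] \<longleftrightarrow> {x, y, z} = universe no_rainbow" by (simp only: list.set)
  moreover have "[x, y, z] \<in> interp no_rainbow R \<longleftrightarrow> {x, y, z} \<noteq> universe no_rainbow"
    using assms unfolding interp by blast
  ultimately show ?thesis by blast
qed

text \<open>The relation says that two of its coordinates coincide, and a permutation preserves and
  reflects equality.\<close>

lemma automorphism_no_rainbow:
  assumes "bij_betw \<gamma> (universe no_rainbow) (universe no_rainbow)"
  shows "automorphism no_rainbow \<gamma>"
proof -
  have "xs \<in> interp no_rainbow R \<longleftrightarrow> map \<gamma> xs \<in> interp no_rainbow R"
    if xs: "xs \<in> tuples (universe no_rainbow) 3" for xs R
  proof -
    obtain x y z where xyz: "xs = [x, y, z]"
      "x \<in> universe no_rainbow" "y \<in> universe no_rainbow" "z \<in> universe no_rainbow"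
      using xs by (auto simp: tuples_def numeral_3_eq_3 length_Suc_conv)
    have "\<gamma> u \<in> universe no_rainbow" if "u \<in> universe no_rainbow" for u
      using assms that by (rule bij_betw_apply)
    moreover have "\<gamma> u = \<gamma> w \<longleftrightarrow> u = w" if "u \<in> universe no_rainbow" "w \<in> universe no_rainbow" for u w
      using assms that by (meson bij_betw_def inj_on_eq_iff)
    ultimately show ?thesis
      unfolding xyz(1) list.map using xyz(2-)
      by (simp only: interp_no_rainbow_iff distinct.simps list.set) auto
  qed
  moreover have "arity no_rainbow = (\<lambda>_. 3)"
    by (simp add: no_rainbow_def)
  ultimately show ?thesis
    using assms by (simp only: automorphism_def) blast
qed

text \<open>Generic names for the three elements: each constraint is proved once for
  \<open>triple a b c\<close>, and \<open>triple_perms\<close> supplies its images under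
  permutations.\<close>

definition triple :: "nat \<Rightarrow> nat \<Rightarrow> nat \<Rightarrow> bool" where
  "triple a b c \<longleftrightarrow> {a, b, c} = universe no_rainbow"

lemma triple_perms:
  assumes "triple a b c"
  shows "triple a c b" "triple b a c" "triple b c a" "triple c a b" "triple c b a"
  using assms by (simp_all add: triple_def insert_commute)

lemma tripleD:
  assumes "triple a b c"
  shows "a \<in> universe no_rainbow" "b \<in> universe no_rainbow" "c \<in> universe no_rainbow" "a \<noteq> b" "a \<noteq> c" "b \<noteq> c"
proof -
  show "a \<in> universe no_rainbow" "b \<in> universe no_rainbow" "c \<in> universe no_rainbow"
    using assms unfolding triple_def by blast+
  have "card {a, b, c} = 3" using assms by (simp add: triple_def universe_no_rainbow)
  then show "a \<noteq> b" "a \<noteq> c" "b \<noteq> c"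
    by (auto simp: card_insert_if split: if_splits)
qed

lemma triple_third:
  assumes "a \<in> universe no_rainbow" "b \<in> universe no_rainbow" "a \<noteq> b"
  obtains c where "triple a b c"
proof -
  \<comment> \<open>The three elements sum to 3, and the subtraction does not truncate because two
    distinct ones sum to at most 3.\<close>
  have "triple a b (3 - a - b)"
    using assms by (auto simp: triple_def universe_no_rainbow)
  then show thesis by (rule that)
qed

lemma triple_cases:
  assumes "triple a b c" "x \<in> universe no_rainbow"
  shows "x = a \<or> x = b \<or> x = c"
  using assms unfolding triple_def by blast

section \<open>Constraints on a member of the hull\<close>

locale no_rainbow_hull =
  fixes V :: "'v set" and h :: "('v, nat, nat) application \<Rightarrow> nat"
  assumes finite_V: "finite V"
    and h_hull: "h \<in> conj_hull no_rainbow (applications V no_rainbow_encoding)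
      (app_maps V bool_domain no_rainbow_encoding)"
begin

abbreviation apps :: "('v, nat, nat) application set" where
  "apps \<equiv> applications V no_rainbow_encoding"

lemma hull_subset:
  assumes "conj_definable no_rainbow apps U" "app_maps V bool_domain no_rainbow_encoding \<subseteq> U"
  shows "h \<in> U"
proof -
  have "finite (universe no_rainbow)" by (simp add: no_rainbow_def)
  from conj_hull_is_least[OF finite_applications[OF finite_V] this app_maps_no_rainbow_subset]
  show ?thesis using assms h_hull by blast
qed

lemma h_extensional: "h \<in> apps \<rightarrow>\<^sub>E universe no_rainbow"
  by (rule hull_subset[OF conj_definable_all app_maps_no_rainbow_subset])

lemma h_mem: "\<alpha> \<in> apps \<Longrightarrow> h \<alpha> \<in> universe no_rainbow"
  using h_extensional by blast

text \<open>An atom that holds in every \<open>t[g]\<close> defines a set containing the hull. All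
  constraints between values of \<open>h\<close> are obtained this way, by evaluating three
  applications at an arbitrary two-valued \<open>g\<close>.\<close>

lemma h_not_rainbow:
  assumes apps: "\<alpha> \<in> apps" "\<beta> \<in> apps" "\<delta> \<in> apps"
    and nr: "\<And>g. (\<And>v. v \<in> V \<Longrightarrow> g v = 0 \<or> g v = Suc 0) \<Longrightarrow>
      \<not> distinct [app_value \<alpha> g, app_value \<beta> g, app_value \<delta> g]"
  shows "h \<alpha> = h \<beta> \<or> h \<alpha> = h \<delta> \<or> h \<beta> = h \<delta>"
proof -
  let ?U = "{h \<in> apps \<rightarrow>\<^sub>E universe no_rainbow. sat no_rainbow h [Atom () [\<alpha>, \<beta>, \<delta>]]}"
  have "formula_over no_rainbow apps [Atom () [\<alpha>, \<beta>, \<delta>]]"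
    using apps by (simp add: formula_over_def tuples_def no_rainbow_def)
  then have "conj_definable no_rainbow apps ?U"
    unfolding conj_definable_def by blast
  moreover have "app_maps V bool_domain no_rainbow_encoding \<subseteq> ?U"
  proof
    fix t assume t: "t \<in> app_maps V bool_domain no_rainbow_encoding"
    then have mem: "t \<in> apps \<rightarrow>\<^sub>E universe no_rainbow"
      using app_maps_no_rainbow_subset by blast
    obtain g where g: "g \<in> V \<rightarrow>\<^sub>E bool_domain" "t = app_map V no_rainbow_encoding g"
      using t by (auto simp: app_maps_def)
    have "\<not> distinct [t \<alpha>, t \<beta>, t \<delta>]"
      using nr[of g] g apps by (auto simp: app_map_def PiE_def Pi_def)
    moreover have "t \<alpha> \<in> universe no_rainbow" "t \<beta> \<in> universe no_rainbow" "t \<delta> \<in> universe no_rainbow"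
      using mem apps by blast+
    ultimately have "sat no_rainbow t [Atom () [\<alpha>, \<beta>, \<delta>]]"
      using interp_no_rainbow_iff[of "t \<alpha>" "t \<beta>" "t \<delta>" "()"] by (simp add: sat_def)
    then show "t \<in> ?U" using mem by blast
  qed
  ultimately have "h \<in> ?U" by (rule hull_subset)
  then have "[h \<alpha>, h \<beta>, h \<delta>] \<in> interp no_rainbow ()"
    by (simp add: sat_def)
  moreover have "h \<alpha> \<in> universe no_rainbow" "h \<beta> \<in> universe no_rainbow" "h \<delta> \<in> universe no_rainbow"
    using h_extensional apps by blast+
  ultimately have "\<not> distinct [h \<alpha>, h \<beta>, h \<delta>]"
    using interp_no_rainbow_iff by blast
  then show ?thesis by auto
qed

abbreviation C :: "nat \<Rightarrow> nat" where
  "C a \<equiv> h (const_app a)"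

abbreviation E :: "'v \<Rightarrow> nat \<Rightarrow> nat \<Rightarrow> nat" where
  "E v a b \<equiv> h (edge_app v a b)"

lemma const_app_mem: "a \<in> universe no_rainbow \<Longrightarrow> const_app a \<in> apps"
  unfolding applications_no_rainbow by blast

lemma edge_app_mem:
  "v \<in> V \<Longrightarrow> a \<in> universe no_rainbow \<Longrightarrow> b \<in> universe no_rainbow \<Longrightarrow> a \<noteq> b \<Longrightarrow> edge_app v a b \<in> apps"
  unfolding applications_no_rainbow by blast

context
  fixes a b c :: nat
  assumes abc: "triple a b c"
begin

lemmas abc_mem = tripleD(1-3)[OF abc]
lemmas abc_neq = tripleD(4-6)[OF abc] tripleD(4-6)[OF abc, symmetric]

text \<open>Read \<open>edge_app v a b\<close> as an edge from \<open>a\<close> to \<open>b\<close>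
  labelled \<open>v\<close>; the names say how two edges meet. Each bit of \<open>v\<close> produces
  a repetition: in \<open>source_1\<close>, bit 0 gives \<open>a, a, b\<close> and bit 1 gives
  \<open>b, c, b\<close>.\<close>

lemma not_rainbow:
  assumes v: "v \<in> V"
  shows const_const: "C a = C b \<or> C a = E v a b \<or> C b = E v a b"
    and source_1: "E v a b = E v a c \<or> E v a b = C b \<or> E v a c = C b"
    and target_1: "E v a b = E v c b \<or> E v a b = C a \<or> E v c b = C a"
    and path: "E v a b = E v b c \<or> E v a b = C b \<or> E v b c = C b"
  by (rule h_not_rainbow;
      simp add: const_app_mem edge_app_mem app_value_edge_app abc_mem abc_neq v)+

text \<open>The bits of \<open>v\<close> and \<open>u\<close> are now independent. In
  \<open>same\<close> and \<open>reverse\<close> only \<open>a\<close> and \<open>b\<close> occur.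
  In the other two, the edges of \<open>v\<close> either both read \<open>a\<close>, or they read
  \<open>b\<close> and \<open>c\<close>, one of which is the reading of \<open>u\<close>.\<close>

lemma not_rainbow2:
  assumes v: "v \<in> V" and u: "u \<in> V"
  shows same: "E v a b = E u a b \<or> E v a b = C a \<or> E u a b = C a"
    and reverse: "E v a b = E u b a \<or> E v a b = C a \<or> E u b a = C a"
    and source_2: "E v a b = E v a c \<or> E v a b = E u b c \<or> E v a c = E u b c"
    and target_2: "E v b a = E v c a \<or> E v b a = E u b c \<or> E v c a = E u b c"
  by (rule h_not_rainbow;
      simp add: const_app_mem edge_app_mem app_value_edge_app abc_mem abc_neq v u)+

end

section \<open>Injective on the constants: recovering the assignment\<close>

lemmas source_1_swap = source_1[OF triple_perms(1)]

text \<open>Each edge takes the value of one of its ends. If the two edges at \<open>a\<close> chose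
  differently, one would have value \<open>C a\<close> and the other that of its far end; the
  constant at the remaining vertex would complete a rainbow.\<close>

lemma edge_bit_source:
  assumes inj: "inj_on C (universe no_rainbow)" and abc: "triple a b c" and v: "v \<in> V"
  shows "E v a b = C a \<longleftrightarrow> E v a c = C a"
proof -
  note D = tripleD[OF abc]
  have "C a \<noteq> C b" "C a \<noteq> C c" "C b \<noteq> C c"
    using inj D by (meson inj_onD)+
  moreover have "E v a b = C a \<or> E v a b = C b"
    using const_const[OF abc v] \<open>C a \<noteq> C b\<close> by auto
  moreover have "E v a c = C a \<or> E v a c = C c"
    using const_const[OF triple_perms(1)[OF abc] v] \<open>C a \<noteq> C c\<close> by auto
  ultimately show ?thesis
    using source_1[OF abc v] source_1_swap[OF abc v] by metis
qed

lemma edge_bit_target: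
  assumes inj: "inj_on C (universe no_rainbow)" and abc: "triple a b c" and v: "v \<in> V"
  shows "E v a b = C a \<longleftrightarrow> E v c b = C c"
proof -
  note D = tripleD[OF abc]
  have "C a \<noteq> C b" "C a \<noteq> C c" "C b \<noteq> C c"
    using inj D by (meson inj_onD)+
  moreover have "E v a b = C a \<or> E v a b = C b"
    using const_const[OF abc v] \<open>C a \<noteq> C b\<close> by auto
  moreover have "E v c b = C c \<or> E v c b = C b"
    using const_const[OF triple_perms(5)[OF abc] v] \<open>C b \<noteq> C c\<close> by auto
  ultimately show ?thesis
    using target_1[OF abc v] target_1[OF triple_perms(5)[OF abc] v] by metis
qed

lemma edge_bit:
  assumes inj: "inj_on C (universe no_rainbow)" and v: "v \<in> V"
    and ab: "a \<in> universe no_rainbow" "b \<in> universe no_rainbow" "a \<noteq> b"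
  shows "E v a b = (if E v 0 1 = C 0 then C a else C b)"
proof -
  have T: "triple 0 1 2"
    by (simp add: triple_def universe_no_rainbow)
  note src = edge_bit_source[OF inj _ v] and tgt = edge_bit_target[OF inj _ v]
  \<comment> \<open>The chain runs through all six ordered pairs, changing the target and the source
    in turn.\<close>
  have "(E v 0 1 = C 0) = (E v 0 2 = C 0)" by (rule src[OF T])
  moreover have "(E v 0 2 = C 0) = (E v 1 2 = C 1)" by (rule tgt[OF triple_perms(1)[OF T]])
  moreover have "(E v 1 2 = C 1) = (E v 1 0 = C 1)" by (rule src[OF triple_perms(3)[OF T]])
  moreover have "(E v 1 0 = C 1) = (E v 2 0 = C 2)" by (rule tgt[OF triple_perms(2)[OF T]])
  moreover have "(E v 2 0 = C 2) = (E v 2 1 = C 2)" by (rule src[OF triple_perms(4)[OF T]])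
  ultimately have "(E v 0 1 = C 0) = (E v a b = C a)"
    using ab unfolding universe_no_rainbow by (elim insertE emptyE) simp_all
  moreover have "C a \<noteq> C b"
    using inj ab by (meson inj_onD)
  moreover obtain c where abc: "triple a b c"
    using triple_third[OF ab] .
  ultimately have "E v a b = C a \<longleftrightarrow> E v 0 1 = C 0" "E v a b = C a \<or> E v a b = C b"
    using const_const[OF abc v] by auto
  then show ?thesis by auto
qed

lemma injective_case:
  assumes inj: "inj_on C (universe no_rainbow)"
  shows "\<exists>\<gamma> t. automorphism no_rainbow \<gamma> \<and> t \<in> app_maps V bool_domain no_rainbow_encoding \<and>
    h = compose apps \<gamma> t"
proof -
  \<comment> \<open>As \<open>t[g]\<close> maps \<open>const_app a\<close> to \<open>a\<close>, the
    automorphism has to be \<open>C\<close> on the universe; the bit of \<open>v\<close> is read off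
    the edge from 0 to 1.\<close>
  let ?g = "\<lambda>v\<in>V. if E v 0 1 = C 0 then 0 else 1"
  have "C ` universe no_rainbow \<subseteq> universe no_rainbow"
    using h_mem const_app_mem by blast
  then have "bij_betw C (universe no_rainbow) (universe no_rainbow)"
    using inj endo_inj_surj[of "universe no_rainbow" C]
    by (simp only: bij_betw_def) (simp add: universe_no_rainbow)
  then have "automorphism no_rainbow C"
    by (rule automorphism_no_rainbow)
  moreover have "?g \<in> V \<rightarrow>\<^sub>E bool_domain" by auto
  then have "app_map V no_rainbow_encoding ?g \<in> app_maps V bool_domain no_rainbow_encoding"
    unfolding app_maps_def by blast
  moreover have "h = compose apps C (app_map V no_rainbow_encoding ?g)"
  proof (rule extensionalityI[of _ apps])
    show "h \<in> extensional apps" using h_extensional by (simp add: PiE_def)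
    show "compose apps C (app_map V no_rainbow_encoding ?g) \<in> extensional apps"
      by (rule compose_extensional)
    fix \<alpha> assume \<alpha>: "\<alpha> \<in> apps"
    have "h \<alpha> = C (app_value \<alpha> ?g)"
      using \<alpha> unfolding applications_no_rainbow
    proof (elim UnE)
      assume "\<alpha> \<in> {edge_app v a b | v a b.
        v \<in> V \<and> a \<in> universe no_rainbow \<and> b \<in> universe no_rainbow \<and> a \<noteq> b}"
      then obtain v a b where "\<alpha> = edge_app v a b" "v \<in> V"
        "a \<in> universe no_rainbow" "b \<in> universe no_rainbow" "a \<noteq> b" by blast
      then show ?thesis
        using edge_bit[OF inj, of v a b] app_value_edge_app[of ?g v a b] by auto
    qed auto
    then show "h \<alpha> = compose apps C (app_map V no_rainbow_encoding ?g) \<alpha>"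
      using \<alpha> by (simp add: compose_def app_map_def)
  qed
  ultimately show ?thesis by blast
qed

section \<open>Two values on the constants\<close>

lemma two_valued_case:
  assumes abc: "triple a b c" and C: "C a = C b" "C a \<noteq> C c"
  shows "h ` apps \<noteq> universe no_rainbow"
proof
  assume surj: "h ` apps = universe no_rainbow"
  have "C a \<in> universe no_rainbow" "C c \<in> universe no_rainbow"
    using h_mem const_app_mem tripleD[OF abc] by blast+
  then obtain r where r: "triple (C a) (C c) r"
    using C(2) triple_third by blast
  \<comment> \<open>The two source constraints would carry the value \<open>r\<close> from
    \<open>E v x y\<close> over to \<open>E v x c\<close>, which \<open>const_const\<close> confines
    to \<open>C x\<close> and \<open>C c\<close>.\<close>
  have no: "E v x y \<noteq> r" if "triple x y c" "C x = C a" "C y = C a" "v \<in> V" for x y v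
    using source_1[OF that(1,4)] source_1_swap[OF that(1,4)]
      const_const[OF triple_perms(1)[OF that(1)] that(4)] C(2) that(2,3) tripleD(4-6)[OF r]
    by metis
  have Cx: "C x = C a \<or> C x = C c" if "x \<in> universe no_rainbow" for x
    using triple_cases[OF abc that] C(1) by metis
  have "r \<in> h ` apps"
    using surj tripleD(3)[OF r] by simp
  then obtain \<alpha> where \<alpha>: "\<alpha> \<in> apps" "h \<alpha> = r" by blast
  have "\<alpha> \<notin> const_app ` universe no_rainbow"
  proof
    assume "\<alpha> \<in> const_app ` universe no_rainbow"
    then obtain x where "\<alpha> = const_app x" "x \<in> universe no_rainbow" by blast
    then show False
      using \<alpha>(2) Cx[of x] tripleD(5,6)[OF r] by metis
  qed
  then obtain v x y where vxy: "\<alpha> = edge_app v x y" "v \<in> V"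
    "x \<in> universe no_rainbow" "y \<in> universe no_rainbow" "x \<noteq> y"
    using \<alpha>(1) unfolding applications_no_rainbow by blast
  obtain z where z: "triple x y z" using triple_third vxy(3-5) .
  have eq: "C x = C y"
    using const_const[OF z vxy(2)] \<alpha>(2) tripleD(5,6)[OF r] Cx[OF vxy(3)] Cx[OF vxy(4)]
    unfolding vxy(1) by metis
  have "x \<noteq> c" "y \<noteq> c"
    using C vxy(5) triple_cases[OF abc vxy(3)] triple_cases[OF abc vxy(4)] eq by metis+
  then have "z = c" "C x = C a"
    using triple_cases[OF z tripleD(3)[OF abc]] triple_cases[OF abc vxy(3)] C(1) by metis+
  then show False
    using no[of x y v] z vxy(1,2) eq \<alpha>(2) by simp
qed

section \<open>One value on the constants\<close>

definition edge :: "bool \<Rightarrow> 'v \<Rightarrow> nat \<Rightarrow> nat \<Rightarrow> nat" where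
  "edge s v a b = (if s then E v a b else E v b a)"

text \<open>The flag \<open>s\<close> reverses both edges at \<open>a\<close> together, which merges
  \<open>source_2\<close> and \<open>target_2\<close>. The flag \<open>w\<close> is free, since
  \<open>u\<close> reads \<open>b\<close> or \<open>c\<close> in either orientation.\<close>

lemma edge_star:
  assumes "triple a b c" "v \<in> V" "u \<in> V"
  shows "edge s v a b = edge s v a c \<or> edge s v a b = edge w u b c \<or> edge s v a c = edge w u b c"
  using source_2[OF assms] source_2[OF triple_perms(1)[OF assms(1)] assms(2,3)]
    target_2[OF assms] target_2[OF triple_perms(1)[OF assms(1)] assms(2,3)]
  by (auto simp: edge_def)

lemma constant_case:
  assumes C: "\<And>x. x \<in> universe no_rainbow \<Longrightarrow> C x = p"
  shows "h ` apps \<noteq> universe no_rainbow"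
proof
  assume surj: "h ` apps = universe no_rainbow"
  \<comment> \<open>Compatibility says that \<open>m\<close>, \<open>n\<close> and the common
    constant value \<open>p\<close> are not rainbow. It holds for edges on the same pair of vertices
    (\<open>rev\<close>), and for edges of one variable with a common vertex (\<open>star\<close>),
    in all orientations.\<close>
  define compat where "compat m n \<longleftrightarrow> m = n \<or> m = p \<or> n = p" for m n
  have rev: "compat (edge s v a b) (edge t u a b)"
    if "triple a b c" "v \<in> V" "u \<in> V" for s t a b c v u
    using same[OF that] same[OF triple_perms(2)[OF that(1)] that(2,3)]
      reverse[OF that] reverse[OF triple_perms(2)[OF that(1)] that(2,3)] C tripleD[OF that(1)]
    by (auto simp: edge_def compat_def)
  have star: "compat (edge s v a b) (edge t v a c)"
    if "triple a b c" "v \<in> V" for s t a b c v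
    using source_1[OF that] target_1[OF triple_perms(2)[OF that(1)] that(2)]
      path[OF triple_perms(2)[OF that(1)] that(2)] path[OF triple_perms(4)[OF that(1)] that(2)]
      C tripleD[OF that(1)]
    by (auto simp: edge_def compat_def)
  have no_star: False
    if abc: "triple a b c" and V: "v \<in> V" "u \<in> V" and qr: "triple p q r"
      and ab: "edge s v a b = q" and ac: "edge t u a c = r" for a b c v u s t q r
  proof -
    note T = triple_perms[OF abc] and D = tripleD[OF qr]
    \<comment> \<open>Being compatible with both \<open>q\<close> and \<open>r\<close> leaves only
      \<open>p\<close>.\<close>
    have vac: "edge s v a c = p"
      using star[OF abc V(1), of s s] rev[OF T(1) V, of s t] ab ac D by (auto simp: compat_def)
    have uab: "edge t u a b = p"
      using star[OF T(1) V(2), of t t] rev[OF abc V, of s t] ab ac D by (auto simp: compat_def)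
    have vbc: "edge w v b c = p" for w
    proof -
      have "compat (edge w v b c) q"
        using star[OF T(2) V(1), of "\<not> s" w] ab by (auto simp: edge_def compat_def split: if_splits)
      moreover have "edge w v b c \<noteq> q"
        using edge_star[OF abc V(2,1), of t w] uab ac D by auto
      ultimately show ?thesis using D by (auto simp: compat_def)
    qed
    have "edge (\<not> s) v b a = q"
      using ab by (simp add: edge_def split: if_splits)
    \<comment> \<open>Around the triangle, the two \<open>v\<close>-edges at \<open>b\<close> carry
      \<open>q\<close> and \<open>p\<close>, and the \<open>u\<close>-edge opposite \<open>b\<close>
      carries \<open>r\<close>: a rainbow against \<open>edge_star\<close>.\<close>
    then show False
      using edge_star[OF T(2) V, of "\<not> s" t] vbc ac D by auto
  qed
  have p: "p \<in> universe no_rainbow"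
    using C[of 0] h_mem[OF const_app_mem[of 0]] by (simp add: universe_no_rainbow)
  have T: "triple 0 1 2"
    by (simp add: triple_def universe_no_rainbow)
  have "\<exists>q r. triple p q r"
    using triple_cases[OF T p] T triple_perms(2,4)[OF T] by metis
  then obtain q r where qr: "triple p q r" by blast
  have edge: "\<exists>v x y. v \<in> V \<and> x \<in> universe no_rainbow \<and> y \<in> universe no_rainbow \<and> x \<noteq> y \<and> E v x y = m"
    if m: "m \<in> universe no_rainbow" "m \<noteq> p" for m
  proof -
    have "m \<in> h ` apps" using surj m(1) by simp
    then obtain \<alpha> where \<alpha>: "\<alpha> \<in> apps" "h \<alpha> = m" by blast
    have "\<alpha> \<notin> const_app ` universe no_rainbow"
      using C m(2) \<alpha>(2) by auto
    then obtain v x y where "\<alpha> = edge_app v x y" "v \<in> V"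
      "x \<in> universe no_rainbow" "y \<in> universe no_rainbow" "x \<noteq> y"
      using \<alpha>(1) unfolding applications_no_rainbow by blast
    then show ?thesis using \<alpha>(2) by blast
  qed
  obtain v x y where v: "v \<in> V" "x \<in> universe no_rainbow" "y \<in> universe no_rainbow" "x \<noteq> y"
    and q: "E v x y = q"
    using edge[OF tripleD(2)[OF qr] tripleD(4)[OF qr, symmetric]] by blast
  obtain u x' y' where u: "u \<in> V" "x' \<in> universe no_rainbow" "y' \<in> universe no_rainbow" "x' \<noteq> y'"
    and r: "E u x' y' = r"
    using edge[OF tripleD(3)[OF qr] tripleD(5)[OF qr, symmetric]] by blast
  obtain z where z: "triple x y z" using triple_third v(2-4) .
  have vq: "edge True v x y = q" "edge False v y x = q"
    using q by (simp_all add: edge_def)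
  \<comment> \<open>Every place for \<open>r\<close> is excluded: the pair \<open>x, y\<close> by
    \<open>rev\<close>, and the pairs meeting it in \<open>x\<close> or in \<open>y\<close> by
    \<open>no_star\<close>, the latter after reversing the edge with value \<open>q\<close>.\<close>
  have "edge t u x y \<noteq> r" "edge t u x z \<noteq> r" "edge t u y z \<noteq> r" for t
    using rev[OF z v(1) u(1), of True t] vq tripleD[OF qr] no_star[OF z v(1) u(1) qr vq(1)]
      no_star[OF triple_perms(2)[OF z] v(1) u(1) qr vq(2)]
    by (auto simp: compat_def)
  from this[of True] this[of False]
  have n: "E u x y \<noteq> r" "E u x z \<noteq> r" "E u y z \<noteq> r" "E u y x \<noteq> r" "E u z x \<noteq> r" "E u z y \<noteq> r"
    by (simp_all add: edge_def)
  show False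
    using u(4) r n triple_cases[OF z u(2)] triple_cases[OF z u(3)] by metis
qed

end

theorem theorem3p4:
  shows "stable TYPE('v) no_rainbow bool_domain no_rainbow_encoding"
  unfolding stable_def
proof (intro allI impI conjI ballI)
  fix V :: "'v set" and t
  assume t: "t \<in> app_maps V bool_domain no_rainbow_encoding"
  then have "t ` applications V no_rainbow_encoding \<subseteq> universe no_rainbow"
    using app_maps_no_rainbow_subset by blast
  \<comment> \<open>The constant applications alone already attain every value, for any
    \<open>g\<close>.\<close>
  moreover have "a \<in> t ` applications V no_rainbow_encoding" if "a \<in> universe no_rainbow" for a
  proof -
    have mem: "const_app a \<in> applications V no_rainbow_encoding"
      using that unfolding applications_no_rainbow by blast
    then have "t (const_app a) = a"
      using t by (auto simp: app_maps_def app_map_def)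
    then show ?thesis using mem by force
  qed
  ultimately show "t ` applications V no_rainbow_encoding = universe no_rainbow" by blast
next
  fix V :: "'v set"
  assume V: "V \<noteq> {} \<and> finite V"
  show "surjectively_closed no_rainbow (applications V no_rainbow_encoding)
      (app_maps V bool_domain no_rainbow_encoding)"
    unfolding surjectively_closed_def
  proof (intro ballI impI)
    fix h
    assume "h \<in> conj_hull no_rainbow (applications V no_rainbow_encoding)
        (app_maps V bool_domain no_rainbow_encoding)"
      and surj: "h ` applications V no_rainbow_encoding = universe no_rainbow"
    then interpret no_rainbow_hull V h
      using V by unfold_locales auto
    have "inj_on C (universe no_rainbow)"
    proof (rule ccontr)
      assume "\<not> inj_on C (universe no_rainbow)"
      then obtain a b where ab: "a \<in> universe no_rainbow" "b \<in> universe no_rainbow" "a \<noteq> b" "C a = C b"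
        by (auto simp: inj_on_def)
      obtain c where c: "triple a b c" using triple_third ab(1-3) .
      \<comment> \<open>Once two constants share a value, surjectivity excludes a different third
        value, which leaves only the constant case.\<close>
      have "C a = C c"
        using two_valued_case[OF c ab(4)] surj by blast
      then have "C x = C a" if "x \<in> universe no_rainbow" for x
        using triple_cases[OF c that] ab(4) by metis
      then show False
        using constant_case surj by blast
    qed
    then show "\<exists>\<gamma> t. automorphism no_rainbow \<gamma> \<and>
        t \<in> app_maps V bool_domain no_rainbow_encoding \<and>
        h = compose (applications V no_rainbow_encoding) \<gamma> t"
      by (rule injective_case)
  qed
qed

end
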